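(* Let $X$ be either $\mathbb R^n$ or a fixed cube $Q\subset\mathbb R^n$, $n\ge1$, and let $\varphi\in\mathrm{BMO}(X)$ be non-constant (i.e., not a.e. equal to a constant). For $\varepsilon\in[0,\varepsilon_\varphi)$ let $F(\varepsilon)=[e^{\varepsilon\varphi}]_{A_\infty(X)}$. Then $F$ is a strictly increasing, continuous function on $[0,\varepsilon_\varphi)$, and $\lim_{\varepsilon\to\varepsilon_\varphi}F(\varepsilon)=\infty$.
   Context: For a cube $J\subset\mathbb R^n$, $\langle\varphi\rangle_J=\frac1{|J|}\int_J\varphi$. $\mathrm{BMO}(X)$ is the set of locally integrable $\varphi$ on $X$ with $\sup_{J\subset X}\langle|\varphi-\langle\varphi\rangle_J|\rangle_J<\infty$, the supremum being over all cubes $J\subset X$. An a.e. positive function $w$ is in $A_\infty(X)$ if $w$ and $\log w$ are locally integrable and $[w]_{A_\infty(X)}:=\sup_{J\subset X}\langle w\rangle_Je^{-\langle\log w\rangle_J}<\infty$, the supremum being over all cubes $J\subset X$. For $\varphi\in\mathrm{BMO}(X)$, $\varepsilon_\varphi=\sup\{\varepsilon>0:\ e^{\varepsilon\varphi}\in A_\infty(X)\}$, which is positive and may be $\infty$. *)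

theory Defs
  imports "HOL-Analysis.Analysis"
begin

text \<open>Cubes are closed, nondegenerate, with edges parallel to the coordinate axes.\<close>

definition is_cube :: "(real^'n) set \<Rightarrow> bool" where
  "is_cube J \<longleftrightarrow> (\<exists>a l. 0 < l \<and> J = cbox a (a + vec l))"

definition cubes_in :: "(real^'n) set \<Rightarrow> (real^'n) set set" where
  "cubes_in X = {J. is_cube J \<and> J \<subseteq> X}"

definition avg :: "(real^'n) set \<Rightarrow> (real^'n \<Rightarrow> real) \<Rightarrow> real" where
  "avg J f = (1 / measure lebesgue J) * (LINT x:J|lebesgue. f x)"

definition locally_integrable_on :: "(real^'n \<Rightarrow> real) \<Rightarrow> (real^'n) set \<Rightarrow> bool" where
  "locally_integrable_on f X \<longleftrightarrow> (\<forall>K. compact K \<and> K \<subseteq> X \<longrightarrow> set_integrable lebesgue K f)"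

definition BMO :: "(real^'n) set \<Rightarrow> (real^'n \<Rightarrow> real) set" where
  "BMO X = {f. locally_integrable_on f X \<and>
     bdd_above ((\<lambda>J. avg J (\<lambda>x. \<bar>f x - avg J f\<bar>)) ` cubes_in X)}"

definition A_infty :: "(real^'n) set \<Rightarrow> (real^'n \<Rightarrow> real) set" where
  "A_infty X = {w. (AE x in lebesgue. x \<in> X \<longrightarrow> 0 < w x) \<and>
     locally_integrable_on w X \<and> locally_integrable_on (\<lambda>x. ln (w x)) X \<and>
     bdd_above ((\<lambda>J. avg J w * exp (- avg J (\<lambda>x. ln (w x)))) ` cubes_in X)}"

text \<open>Meaningful only for weights in \<^term>\<open>A_infty X\<close>; otherwise the real supremum
  (or the integrals in it) may be an unspecified value.\<close>

definition A_infty_const :: "(real^'n) set \<Rightarrow> (real^'n \<Rightarrow> real) \<Rightarrow> real" where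
  "A_infty_const X w = (SUP J\<in>cubes_in X. avg J w * exp (- avg J (\<lambda>x. ln (w x))))"

definition eps_crit :: "(real^'n) set \<Rightarrow> (real^'n \<Rightarrow> real) \<Rightarrow> ereal" where
  "eps_crit X \<phi> = Sup (ereal ` {\<epsilon>. 0 < \<epsilon> \<and> (\<lambda>x. exp (\<epsilon> * \<phi> x)) \<in> A_infty X})"

definition F_fun :: "(real^'n) set \<Rightarrow> (real^'n \<Rightarrow> real) \<Rightarrow> real \<Rightarrow> real" where
  "F_fun X \<phi> \<epsilon> = A_infty_const X (\<lambda>x. exp (\<epsilon> * \<phi> x))"

end

theory Submission
  imports Defs
begin

text \<open>
  For a cube J the function ln of the A-infinity ratio of exp (t f) over J is convex in t, vanishes
  at 0, and is positive for t > 0 unless f is constant on J. Hence so is its supremum ln F; this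
  gives monotonicity, continuity, and the blow-up when the critical exponent is infinite.

  When it is finite, F must blow up because the A-infinity condition improves itself: if the ratio
  of exp f is at most C on all cubes, then the ratio of exp ((1 + d) f) is bounded, with d depending
  only on C and the dimension. This is shown with the Bellman function
  B(x, y) = 2 y^(1+d) - y^(d-1) e^(2x) of the averages x of f and y of exp f. Its value at a cube
  dominates the mean of its values at the dyadic subcubes, since e^(2x) / y is convex. Iterating
  along a dyadic division that is fine for a gauge, Henstock's lemma passes to the limit
  without any differentiation theorem.

  If no exponent is admissible, the critical exponent is the supremum of the empty set, i.e.
  minus infinity, and every claim is void.
\<close>

section \<open>A Bellman function\<close>

text \<open>With q = sqrt r, the bound ln q <= q - 1 leaves a surplus (q - 1)^2 below r - 1, and
  this is (r - 1)^2 / (q + 1)^2 with (q + 1)^2 <= 4 * m. The surplus later pays for the quadratic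
  loss in \<open>powr_one_plus_upper_bound\<close>.\<close>

lemma ln_quadratic_upper_bound:
  fixes r m :: real
  assumes "0 < r" "r \<le> m" "1 \<le> m"
  shows "ln r \<le> r - 1 - (r - 1)\<^sup>2 / (4 * m)"
proof -
  define q where "q = sqrt r"
  have q: "0 < q" "r = q\<^sup>2" using assms by (auto simp: q_def)
  have "ln r = 2 * ln q" using q by (simp add: ln_realpow)
  also have "\<dots> \<le> 2 * (q - 1)" using q ln_le_minus_one[of q] by simp
  finally have 1: "ln r \<le> r - 1 - (q - 1)\<^sup>2" using q by (simp add: power2_eq_square algebra_simps)
  have "(1 - q)\<^sup>2 \<ge> 0" by simp
  then have "(q + 1)\<^sup>2 \<le> 2 * q\<^sup>2 + 2" by (simp add: power2_eq_square algebra_simps)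
  also have "\<dots> \<le> 4 * m" using assms q by simp
  finally have "(q + 1)\<^sup>2 \<le> 4 * m" .
  then have "(q - 1)\<^sup>2 * (q + 1)\<^sup>2 \<le> (q - 1)\<^sup>2 * (4 * m)" by (intro mult_left_mono) auto
  moreover have "(q - 1)\<^sup>2 * (q + 1)\<^sup>2 = (r - 1)\<^sup>2" using q by (simp add: power2_eq_square algebra_simps)
  ultimately have "(r - 1)\<^sup>2 / (4 * m) \<le> (q - 1)\<^sup>2" using assms by (simp add: field_simps)
  then show ?thesis using 1 by simp
qed

text \<open>Convexity of exp between 0 and ln r gives Bernoulli's inequality for r^d; multiply it by
  r. What matters is that the quadratic loss carries the small factor d.\<close>

lemma powr_one_plus_upper_bound:
  fixes r d :: real
  assumes "0 < r" "0 \<le> d" "d \<le> 1"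
  shows "r powr (1 + d) \<le> r + d * (r - 1) + d * (r - 1)\<^sup>2"
proof -
  have "r powr d \<le> 1 + d * (r - 1)"
  proof -
    have "exp ((1 - d) *\<^sub>R 0 + d *\<^sub>R ln r) \<le> (1 - d) * exp 0 + d * exp (ln r)"
      using assms by (intro convex_onD[OF exp_convex]) auto
    then show ?thesis using assms by (simp add: powr_def algebra_simps)
  qed
  then have "r * r powr d \<le> r * (1 + d * (r - 1))" using assms by (intro mult_left_mono) auto
  then show ?thesis using assms by (simp add: powr_add power2_eq_square algebra_simps)
qed

text \<open>For y > 0 this is \<open>y powr (1 + d) * (2 - (exp x / y)\<^sup>2)\<close>. Jensen's
  inequality puts exp x / y in the interval (0, 1], so the value is within a factor 2 of the target
  y^(1+d), while the concave second term compensates the convexity of the first.\<close>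

definition bellman :: "real \<Rightarrow> real \<Rightarrow> real \<Rightarrow> real" where
  "bellman d x y = 2 * y powr (1 + d) - y powr (d - 1) * exp (2 * x)"

lemma bellman_bounds:
  assumes "exp x \<le> y"
  shows "y powr (1 + d) \<le> bellman d x y" "bellman d x y \<le> 2 * y powr (1 + d)"
proof -
  have y: "0 < y" using assms exp_gt_zero[of x] by linarith
  have "exp (2 * x) = exp x ^ 2" by (metis exp_double)
  also have "\<dots> \<le> y ^ 2" using assms by (intro power_mono) auto
  also have "\<dots> = y powr 2" using y by simp
  finally have "y powr (d - 1) * exp (2 * x) \<le> y powr (d - 1) * y powr 2" by (intro mult_left_mono) auto
  also have "\<dots> = y powr (1 + d)" by (metis powr_add add.commute diff_add_eq add_diff_cancel_left' one_add_one add_diff_eq)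
  finally show "y powr (1 + d) \<le> bellman d x y" by (simp add: bellman_def)
  show "bellman d x y \<le> 2 * y powr (1 + d)" by (simp add: bellman_def)
qed

text \<open>Normalise to r = y / Y and let V be the sum of (r - 1)^2. The power term exceeds its
  value at the mean by at most 2 * d * V, the subtracted term by at least k * V / (8 * m), where k =
  exp (2 * X) / Y^2 >= 1 / C^2. The choice of d makes the gain cover the loss. The comparison of Y
  with exp X is needed at the mean only.\<close>

lemma sum_bellman_le:
  fixes x y :: "'s \<Rightarrow> real" and C m d X Y :: real
  assumes S: "finite S" "S \<noteq> {}" and m: "m = card S"
    and pos: "\<And>s. s \<in> S \<Longrightarrow> 0 < y s"
    and X: "m * X = sum x S" and Y: "m * Y = sum y S"
    and C: "1 \<le> C" "Y \<le> C * exp X" and d: "d = 1 / (16 * m * C\<^sup>2)"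
  shows "(\<Sum>s\<in>S. bellman d (x s) (y s)) \<le> m * bellman d X Y"
proof -
  have m1: "1 \<le> m" using S m by (simp add: Suc_leI card_gt_0_iff)
  have "0 < sum y S" using S pos by (intro sum_pos) auto
  then have Y0: "0 < Y" using m1 by (simp add: zero_less_mult_iff flip: Y)
  have C2: "1 \<le> C\<^sup>2" using C by (simp add: one_le_power)
  have "1 \<le> m * C\<^sup>2" using mult_mono[OF m1 C2] m1 by simp
  then have d01: "0 < d" "d \<le> 1/2" unfolding d by (auto simp: field_simps)
  define r where "r s = y s / Y" for s
  define V where "V = (\<Sum>s\<in>S. (r s - 1)\<^sup>2)"
  define k where "k = exp (2 * X) / Y\<^sup>2"
  have V0: "0 \<le> V" unfolding V_def by (intro sum_nonneg) auto
  have r0: "0 < r s" if "s \<in> S" for s using pos[OF that] Y0 by (simp add: r_def)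
  have sr: "sum r S = m" unfolding r_def using Y Y0 by (simp flip: sum_divide_distrib Y)
  \<comment> \<open>The points need not be close to the mean, so the quadratic gain needs an upper
    bound on r; positivity and the total m supply it.\<close>
  have rm: "r s \<le> m" if "s \<in> S" for s
    using member_le_sum[of s S r] sr S that r0 by (simp add: less_imp_le)
  have s1: "(\<Sum>s\<in>S. r s powr (1 + d)) \<le> m + d * V"
  proof -
    have "(\<Sum>s\<in>S. r s powr (1 + d)) \<le> (\<Sum>s\<in>S. r s + d * (r s - 1) + d * (r s - 1)\<^sup>2)"
      using d01 r0 by (intro sum_mono powr_one_plus_upper_bound) auto
    also have "\<dots> = sum r S + d * (sum r S - m) + d * V"
      by (simp add: sum.distrib sum_distrib_left sum_subtractf V_def m right_diff_distrib mult.commute)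
    finally show ?thesis using sr by simp
  qed
  \<comment> \<open>exp (Z s) is the ratio of the subtracted Bellman term at s to its value at the
    mean. In the sum of Z the part 2 * (x s - X) cancels, so only the logarithms remain, and exp Z
    >= 1 + Z suffices.\<close>
  define Z where "Z s = 2 * (x s - X) + (d - 1) * ln (r s)" for s
  have s2: "m + V / (8 * m) \<le> (\<Sum>s\<in>S. exp (Z s))"
  proof -
    have "(\<Sum>s\<in>S. ln (r s)) \<le> (\<Sum>s\<in>S. r s - 1 - (r s - 1)\<^sup>2 / (4 * m))"
      using r0 rm m1 by (intro sum_mono ln_quadratic_upper_bound) auto
    also have "\<dots> = sum r S - m - V / (4 * m)"
      by (simp add: sum_subtractf m V_def sum_divide_distrib)
    finally have l: "V / (4 * m) \<le> - (\<Sum>s\<in>S. ln (r s))" using sr by simp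
    have "V / (8 * m) = (1/2) * (V / (4 * m))" by simp
    also have "\<dots> \<le> (1 - d) * (V / (4 * m))" using d01 V0 m1 by (intro mult_right_mono) auto
    also have "\<dots> \<le> (1 - d) * (- (\<Sum>s\<in>S. ln (r s)))" using d01 l by (intro mult_left_mono) auto
    also have "\<dots> = (\<Sum>s\<in>S. Z s)"
      unfolding Z_def using X by (simp add: sum.distrib sum_subtractf flip: sum_distrib_left m) (simp add: algebra_simps)
    finally have "m + V / (8 * m) \<le> (\<Sum>s\<in>S. 1 + Z s)" by (simp add: sum.distrib m)
    also have "\<dots> \<le> (\<Sum>s\<in>S. exp (Z s))" by (intro sum_mono) (rule exp_ge_add_one_self)
    finally show ?thesis .
  qed
  have "Y\<^sup>2 \<le> (C * exp X)\<^sup>2" using C Y0 by (intro power_mono) auto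
  then have k: "1 / C\<^sup>2 \<le> k" unfolding k_def using C Y0
    unfolding exp_double by (simp add: field_simps power_mult_distrib)
  have eq: "bellman d (x s) (y s) = Y powr (1 + d) * (2 * r s powr (1 + d) - k * exp (Z s))"
    if "s \<in> S" for s
  proof -
    have ys: "y s = Y * r s" using Y0 by (simp add: r_def)
    have e: "exp (Z s) = exp (2 * x s) / exp (2 * X) * r s powr (d - 1)"
      using r0[OF that] by (simp add: Z_def exp_add powr_def right_diff_distrib exp_diff)
    have "Y powr (1 + d) = Y powr (d - 1) * Y powr 2" by (metis powr_add add.commute diff_add_eq add_diff_cancel_left' one_add_one add_diff_eq)
    then have p: "Y powr (1 + d) = Y powr (d - 1) * Y\<^sup>2" using Y0 by simp
    have "Y powr (1 + d) * (k * exp (Z s)) = Y powr (d - 1) * r s powr (d - 1) * exp (2 * x s)"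
      unfolding e p k_def using Y0 by simp
    then show ?thesis
      unfolding bellman_def ys using r0[OF that] Y0 by (simp add: powr_mult right_diff_distrib)
  qed
  have "2 * (d * V) = 1 / C\<^sup>2 * (V / (8 * m))" by (simp add: d)
  also have "\<dots> \<le> k * (V / (8 * m))" using k V0 m1 by (intro mult_right_mono) auto
  finally have f: "2 * (d * V) \<le> k * (V / (8 * m))" .
  have kp: "0 \<le> k" by (simp add: k_def)
  have "(\<Sum>s\<in>S. bellman d (x s) (y s)) = (\<Sum>s\<in>S. Y powr (1 + d) * (2 * r s powr (1 + d) - k * exp (Z s)))"
    by (intro sum.cong eq refl)
  also have "\<dots> = Y powr (1 + d) * (2 * (\<Sum>s\<in>S. r s powr (1 + d)) - k * (\<Sum>s\<in>S. exp (Z s)))"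
    by (simp add: sum_distrib_left sum_subtractf right_diff_distrib)
  also have "\<dots> \<le> Y powr (1 + d) * (2 * (m + d * V) - k * (m + V / (8 * m)))"
    using s1 s2 kp by (intro mult_left_mono diff_mono) auto
  also have "\<dots> \<le> Y powr (1 + d) * (m * (2 - k))"
    using f by (intro mult_left_mono) (auto simp: algebra_simps)
  also have "\<dots> = m * bellman d X Y"
  proof -
    have "Y powr (1 + d) = Y powr (d - 1) * Y powr 2" by (metis powr_add add.commute diff_add_eq add_diff_cancel_left' one_add_one add_diff_eq)
    then have p: "Y powr (1 + d) = Y powr (d - 1) * Y\<^sup>2" using Y0 by simp
    then have "Y powr (1 + d) * k = Y powr (d - 1) * exp (2 * X)" using Y0 by (simp add: k_def)
    then show ?thesis by (simp add: bellman_def algebra_simps)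
  qed
  finally show ?thesis .
qed

section \<open>Dyadic subdivision of cubes\<close>

abbreviation cube :: "real^'n \<Rightarrow> real \<Rightarrow> (real^'n) set" where
  "cube a l \<equiv> cbox a (a + vec l)"

text \<open>A dyadic child is indexed by the set of coordinates in which it occupies the upper half,
  which gives 2^n children.\<close>

definition subcube_corner :: "real^'n \<Rightarrow> real \<Rightarrow> 'n set \<Rightarrow> real^'n" where
  "subcube_corner a l s = (\<chi> i. if i \<in> s then a $ i + l / 2 else a $ i)"

abbreviation subcube :: "real^'n \<Rightarrow> real \<Rightarrow> 'n set \<Rightarrow> (real^'n) set" where
  "subcube a l s \<equiv> cube (subcube_corner a l s) (l / 2)"

lemma is_cube_cube: "0 < l \<Longrightarrow> is_cube (cube a l)"
  by (auto simp: is_cube_def)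

lemma is_cubeE:
  assumes "is_cube J" obtains a l where "0 < l" "J = cube a l"
  using assms by (auto simp: is_cube_def)

lemma mem_cube: "x \<in> cube a l \<longleftrightarrow> (\<forall>i. a $ i \<le> x $ i \<and> x $ i \<le> a $ i + l)"
  by (simp add: mem_box_cart)

lemma measure_cube:
  fixes a :: "real^'n"
  assumes "0 < l" shows "measure lebesgue (cube a l) = l ^ CARD('n)"
proof -
  have "a \<in> cube a l" using assms by (simp add: mem_cube)
  then have "cube a l \<noteq> {}" by blast
  then show ?thesis by (simp add: content_cbox_cart)
qed

lemma measure_subcube:
  fixes a :: "real^'n"
  assumes "0 < l"
  shows "2 ^ CARD('n) * measure lebesgue (subcube a l s) = measure lebesgue (cube a l)"
  unfolding measure_cube[OF assms] measure_cube[OF half_gt_zero[OF assms]] by (simp add: power_divide)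

lemma interior_subcubes_disjoint:
  assumes "s \<noteq> t"
  shows "interior (subcube a l s) \<inter> interior (subcube a l t) = {}"
proof -
  obtain i where i: "i \<in> s \<longleftrightarrow> i \<notin> t" using assms by blast
  have False if "x \<in> interior (subcube a l s)" "x \<in> interior (subcube a l t)" for x
  proof -
    have "subcube_corner a l s $ i < x $ i \<and> x $ i < subcube_corner a l s $ i + l / 2"
      "subcube_corner a l t $ i < x $ i \<and> x $ i < subcube_corner a l t $ i + l / 2"
      using that unfolding interior_cbox mem_box_cart by simp_all
    then show False using i by (auto simp: subcube_corner_def split: if_splits)
  qed
  then show ?thesis by blast
qed

lemma corner_in_cube: "0 < l \<Longrightarrow> a \<in> cube a l"
  by (simp add: mem_cube)

lemma interior_cube_nonempty:
  fixes a :: "real^'n"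
  assumes "0 < l" shows "interior (cube a l) \<noteq> {}"
proof -
  have "a + vec (l / 2) \<in> interior (cube a l)" using assms by (simp add: mem_box_cart)
  then show ?thesis by blast
qed

text \<open>Children with different index sets have disjoint nonempty interiors. Injectivity allows
  sums over the division to be reindexed by \<open>s\<close>.\<close>

lemma inj_subcube:
  fixes a :: "real^'n"
  assumes "0 < l" shows "inj (subcube a l)"
proof (rule injI, rule ccontr)
  fix s t assume "subcube a l s = subcube a l t" "s \<noteq> t"
  then show False
    using interior_subcubes_disjoint[of s t a l] interior_cube_nonempty[of "l/2" "subcube_corner a l t"] assms by simp
qed

lemma subcube_subset:
  assumes l: "0 < l" shows "subcube a l s \<subseteq> cube a l"
proof (rule subsetI, unfold mem_cube, rule allI)
  fix x i assume "\<forall>i. subcube_corner a l s $ i \<le> x $ i \<and> x $ i \<le> subcube_corner a l s $ i + l / 2"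
  then have "subcube_corner a l s $ i \<le> x $ i \<and> x $ i \<le> subcube_corner a l s $ i + l / 2" ..
  then show "a $ i \<le> x $ i \<and> x $ i \<le> a $ i + l"
    using l by (auto simp: subcube_corner_def split: if_splits)
qed

lemma subcubes_division_of:
  fixes a :: "real^'n"
  assumes l: "0 < l"
  shows "range (subcube a l) division_of cube a l"
proof (rule division_ofI)
  show "finite (range (subcube a l))" by simp
  fix K assume "K \<in> range (subcube a l)"
  then obtain s where s: "K = subcube a l s" by blast
  show "K \<subseteq> cube a l" using s subcube_subset[OF l] by simp
  show "K \<noteq> {}" using corner_in_cube[OF half_gt_zero[OF l]] unfolding s by blast
  show "\<exists>a b. K = cbox a b" unfolding s by (rule exI, rule exI, rule refl)
  fix L assume "L \<in> range (subcube a l)" "K \<noteq> L"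
  then obtain t where t: "L = subcube a l t" and "s \<noteq> t" using s by blast
  show "interior K \<inter> interior L = {}" unfolding s t by (rule interior_subcubes_disjoint) fact
next
  show "\<Union>(range (subcube a l)) = cube a l"
  proof safe
    show "x \<in> cube a l" if "x \<in> subcube a l s" for x s
      using subcube_subset[OF l] that by blast
  next
    fix x assume x: "x \<in> cube a l"
    \<comment> \<open>The child is chosen by recording the coordinates in which x lies in the upper
      half; points on a middle hyperplane go to the upper child.\<close>
    have "x \<in> subcube a l {i. a $ i + l / 2 \<le> x $ i}"
      unfolding mem_cube
    proof
      fix i
      have "a $ i \<le> x $ i \<and> x $ i \<le> a $ i + l" using x unfolding mem_cube ..
      then show "subcube_corner a l {i. a $ i + l / 2 \<le> x $ i} $ i \<le> x $ i
        \<and> x $ i \<le> subcube_corner a l {i. a $ i + l / 2 \<le> x $ i} $ i + l / 2"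
        by (auto simp add: subcube_corner_def)
    qed
    then show "x \<in> \<Union>(range (subcube a l))" by blast
  qed
qed

lemma dist_in_cube:
  fixes a :: "real^'n" and l :: real
  assumes "x \<in> cube a l" "y \<in> cube a l"
  shows "dist x y \<le> CARD('n) * l"
proof -
  have "dist x y \<le> (\<Sum>i\<in>UNIV. \<bar>(x - y) $ i\<bar>)"
    unfolding dist_norm by (rule norm_le_l1_cart)
  also have "\<dots> \<le> (\<Sum>i\<in>(UNIV::'n set). l)"
  proof (rule sum_mono)
    fix i
    have "a $ i \<le> x $ i \<and> x $ i \<le> a $ i + l" "a $ i \<le> y $ i \<and> y $ i \<le> a $ i + l"
      using assms unfolding mem_cube by blast+
    then show "\<bar>(x - y) $ i\<bar> \<le> l" by auto
  qed
  finally show ?thesis by simp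
qed

text \<open>Cousin's bisection argument: if \<open>P\<close> fails on a cube, it fails on some
  child. The resulting nested failing cubes meet in a point z and eventually lie in any ball around
  z, against \<open>small\<close>.\<close>

lemma cube_bisection_induct:
  fixes a :: "real^'n"
  assumes "0 < l"
    and split: "\<And>b r. 0 < r \<Longrightarrow> cube b r \<subseteq> cube a l
      \<Longrightarrow> (\<And>s. P (subcube_corner b r s) (r / 2)) \<Longrightarrow> P b r"
    and small: "\<And>z. \<exists>e>0. \<forall>b r. 0 < r \<and> z \<in> cube b r \<and> cube b r \<subseteq> ball z e \<longrightarrow> P b r"
  shows "P a l"
proof (rule ccontr)
  assume neg: "\<not> P a l"
  have "\<exists>c. \<forall>k. (cube (c k) (l / 2 ^ k) \<subseteq> cube a l \<and> \<not> P (c k) (l / 2 ^ k))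
      \<and> cube (c (Suc k)) (l / 2 ^ Suc k) \<subseteq> cube (c k) (l / 2 ^ k)"
  proof (rule dependent_nat_choice)
    show "\<exists>c. cube c (l / 2 ^ 0) \<subseteq> cube a l \<and> \<not> P c (l / 2 ^ 0)" using neg by auto
  next
    fix c k assume c: "cube c (l / 2 ^ k) \<subseteq> cube a l \<and> \<not> P c (l / 2 ^ k)"
    have l: "0 < l / 2 ^ k" using assms by simp
    obtain s where s: "\<not> P (subcube_corner c (l / 2 ^ k) s) (l / 2 ^ k / 2)"
    proof (rule ccontr)
      assume "\<not> thesis"
      then have "P (subcube_corner c (l / 2 ^ k) s) (l / 2 ^ k / 2)" for s using that by blast
      then show False using split[OF l] c by blast
    qed
    have "subcube c (l / 2 ^ k) s \<subseteq> cube c (l / 2 ^ k)" by (rule subcube_subset[OF l])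
    moreover have eq: "l / 2 ^ k / 2 = l / 2 ^ Suc k" by simp
    ultimately show "\<exists>c'. (cube c' (l / 2 ^ Suc k) \<subseteq> cube a l \<and> \<not> P c' (l / 2 ^ Suc k))
        \<and> cube c' (l / 2 ^ Suc k) \<subseteq> cube c (l / 2 ^ k)"
      using s c unfolding eq by (intro exI[of _ "subcube_corner c (l / 2 ^ k) s"] conjI) auto
  qed
  then obtain c where c: "\<And>k. \<not> P (c k) (l / 2 ^ k)"
    "\<And>k. cube (c (Suc k)) (l / 2 ^ Suc k) \<subseteq> cube (c k) (l / 2 ^ k)" by blast
  have lk: "0 < l / 2 ^ k" for k using assms by simp
  have "\<Inter>(range (\<lambda>k. cube (c k) (l / 2 ^ k))) \<noteq> {}"
  proof (rule compact_nest)
    show "cube (c k) (l / 2 ^ k) \<noteq> {}" for k using corner_in_cube[OF lk] by blast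
    show "cube (c n) (l / 2 ^ n) \<subseteq> cube (c m) (l / 2 ^ m)" if "m \<le> n" for m n
      using lift_Suc_antimono_le[of "\<lambda>k. cube (c k) (l / 2 ^ k)", OF c(2) that] .
  qed auto
  then obtain z where z: "\<And>k. z \<in> cube (c k) (l / 2 ^ k)" by blast
  obtain e where e: "0 < e" "\<And>b r. 0 < r \<Longrightarrow> z \<in> cube b r \<Longrightarrow> cube b r \<subseteq> ball z e \<Longrightarrow> P b r"
    using small[of z] by blast
  have "(\<lambda>k. CARD('n) * l * (1/2) ^ k) \<longlonglongrightarrow> CARD('n) * l * 0"
    by (intro tendsto_mult_left LIMSEQ_realpow_zero) auto
  then have "eventually (\<lambda>k. CARD('n) * l * (1/2) ^ k < e) sequentially"
    using e(1) by (intro order_tendstoD) auto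
  then obtain k where k: "CARD('n) * l * (1/2) ^ k < e" by (auto dest: eventually_happens)
  have "cube (c k) (l / 2 ^ k) \<subseteq> ball z e"
  proof
    fix x assume "x \<in> cube (c k) (l / 2 ^ k)"
    from dist_in_cube[OF z this] k show "x \<in> ball z e" by (simp add: power_one_over)
  qed
  then show False using e(2)[OF lk z] c(1) by blast
qed

section \<open>Averages over cubes\<close>

lemma cube_sets [measurable]: "is_cube J \<Longrightarrow> J \<in> sets lebesgue"
  by (auto simp: is_cube_def)

lemma measure_is_cube_pos: "is_cube J \<Longrightarrow> 0 < measure lebesgue J"
  using measure_cube by (metis is_cubeE zero_less_power)

lemma set_integrable_subcube:
  fixes f :: "real^'n \<Rightarrow> real"
  shows "set_integrable lebesgue J f \<Longrightarrow> is_cube K \<Longrightarrow> K \<subseteq> J \<Longrightarrow> set_integrable lebesgue K f"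
  by (rule set_integrable_subset) (auto simp: cube_sets)

lemma set_integrable_const_cube:
  "is_cube J \<Longrightarrow> set_integrable lebesgue J (\<lambda>x. c::real)"
  by (auto simp: is_cube_def intro!: absolutely_integrable_on_const)

lemma avg_const:
  assumes "is_cube J" shows "avg J (\<lambda>x. c) = c"
proof -
  have "(LINT x:J|lebesgue. c) = measure lebesgue J * c"
    using assms by (auto simp: set_lebesgue_integral_def is_cube_def)
  then show ?thesis using measure_is_cube_pos[OF assms] by (simp add: avg_def)
qed

lemma avg_add:
  "set_integrable lebesgue J f \<Longrightarrow> set_integrable lebesgue J g
    \<Longrightarrow> avg J (\<lambda>x. f x + g x) = avg J f + avg J g"
  by (simp add: avg_def set_integral_add ring_distribs)

lemma avg_cmult: "avg J (\<lambda>x. c * f x) = c * avg J f"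
  by (simp add: avg_def)

lemma avg_mono:
  assumes "set_integrable lebesgue J f" "set_integrable lebesgue J g" "\<And>x. x \<in> J \<Longrightarrow> f x \<le> g x"
  shows "avg J f \<le> avg J g"
  unfolding avg_def by (intro mult_left_mono set_integral_mono assms) auto

lemma avg_eq_integral:
  "set_integrable lebesgue J f \<Longrightarrow> avg J f = integral J f / measure lebesgue J"
  by (simp add: avg_def set_lebesgue_integral_eq_integral(2))

text \<open>Jensen's inequality, obtained by averaging the tangent line of exp at the mean
  \<open>A\<close>.\<close>

lemma exp_avg_le:
  assumes J: "is_cube J" and f: "set_integrable lebesgue J f" and e: "set_integrable lebesgue J (\<lambda>x. exp (f x))"
  shows "exp (avg J f) \<le> avg J (\<lambda>x. exp (f x))"
proof -
  define A where "A = avg J f"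
  have i: "set_integrable lebesgue J (\<lambda>x. exp A * f x)" "set_integrable lebesgue J (\<lambda>x. exp A * (1 - A))"
    using f J by (auto intro!: set_integrable_const_cube)
  have "exp A = avg J (\<lambda>x. exp A * f x) + avg J (\<lambda>x. exp A * (1 - A))"
    unfolding avg_const[OF J] avg_cmult A_def[symmetric] by (simp add: algebra_simps)
  also have "\<dots> = avg J (\<lambda>x. exp A * f x + exp A * (1 - A))"
    using i by (rule avg_add[symmetric])
  also have "\<dots> \<le> avg J (\<lambda>x. exp (f x))"
  proof (rule avg_mono)
    show "set_integrable lebesgue J (\<lambda>x. exp A * f x + exp A * (1 - A))" using i by (rule set_integral_add)
    show "exp A * f x + exp A * (1 - A) \<le> exp (f x)" for x
    proof -
      have "exp A * (1 + (f x - A)) \<le> exp A * exp (f x - A)"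
        by (intro mult_left_mono exp_ge_add_one_self) auto
      then show ?thesis by (simp add: algebra_simps flip: exp_add)
    qed
  qed (fact e)
  finally show ?thesis by (simp add: A_def)
qed

text \<open>All children have the same measure, so the average over the parent is the plain mean of
  the children's averages, as \<open>sum_bellman_le\<close> requires with m = 2^n.\<close>

lemma sum_avg_subcubes:
  fixes f :: "real^'n \<Rightarrow> real"
  assumes l: "0 < l" and f: "set_integrable lebesgue (cube a l) f"
  shows "2 ^ CARD('n) * avg (cube a l) f = (\<Sum>s\<in>UNIV. avg (subcube a l s) f)"
proof -
  have fs: "set_integrable lebesgue (subcube a l s) f" for s
    using l by (intro set_integrable_subcube[OF f] is_cube_cube subcube_subset) auto
  have mp: "measure lebesgue (cube a l) \<noteq> 0" using measure_is_cube_pos[OF is_cube_cube[OF l]] by (metis less_irrefl)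
  have m: "measure lebesgue (subcube a l s) = measure lebesgue (cube a l) / 2 ^ CARD('n)" for s
    unfolding measure_subcube[OF l, of a s, symmetric] by simp
  have "integral (cube a l) f = (\<Sum>K\<in>range (subcube a l). integral K f)"
    by (intro integral_combine_division_topdown subcubes_division_of l set_lebesgue_integral_eq_integral(1) f)
  also have "\<dots> = (\<Sum>s\<in>UNIV. integral (subcube a l s) f)"
    by (subst sum.reindex[OF inj_subcube[OF l]]) simp
  finally show ?thesis
    unfolding avg_eq_integral[OF f] avg_eq_integral[OF fs] m
    by (simp add: sum_divide_distrib[symmetric] sum_distrib_left mult.commute)
qed

section \<open>Gauge-fine divisions into cubes that do not increase the Bellman sum\<close>

text \<open>By bisection induction: a cube inside the gauge neighbourhood of one of its points is
  its own division, and otherwise the divisions of the children are united.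
  \<open>sum_bellman_le\<close> shows that \<open>b\<close> of the parent dominates the sum over the
  children; it applies at every stage because the bound by \<open>C\<close> is assumed on all
  subcubes.\<close>

lemma fine_cube_division_exists:
  fixes f :: "real^'n \<Rightarrow> real"
  assumes l: "0 < l"
    and f: "set_integrable lebesgue (cube a l) f" and e: "set_integrable lebesgue (cube a l) (\<lambda>x. exp (f x))"
    and C: "1 \<le> C" "\<And>K. is_cube K \<Longrightarrow> K \<subseteq> cube a l \<Longrightarrow> avg K (\<lambda>x. exp (f x)) \<le> C * exp (avg K f)"
    and d: "d = 1 / (16 * 2 ^ CARD('n) * C\<^sup>2)" and "gauge \<gamma>"
  defines "b \<equiv> \<lambda>K. measure lebesgue K * bellman d (avg K f) (avg K (\<lambda>x. exp (f x)))"
  shows "\<exists>p. p tagged_division_of (cube a l) \<and> \<gamma> fine p \<and> (\<forall>(x, K)\<in>p. is_cube K)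
    \<and> (\<Sum>(x, K)\<in>p. b K) \<le> b (cube a l)"
proof -
  define P where "P K p \<longleftrightarrow> p tagged_division_of K \<and> \<gamma> fine p \<and> (\<forall>(x, K)\<in>p. is_cube K)
    \<and> (\<Sum>(x, K)\<in>p. b K) \<le> b K" for K and p :: "((real^'n) \<times> (real^'n) set) set"
  have "\<exists>p. P (cube a l) p"
  proof (rule cube_bisection_induct[where P = "\<lambda>c r. \<exists>p. P (cube c r) p", OF l])
    fix z
    have "open (\<gamma> z)" "z \<in> \<gamma> z" using \<open>gauge \<gamma>\<close> by (auto simp: gauge_def)
    then obtain e where e: "e > 0" "ball z e \<subseteq> \<gamma> z" by (meson open_contains_ball)
    have "\<exists>p. P (cube c r) p" if "0 < r" "z \<in> cube c r" "cube c r \<subseteq> ball z e" for c r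
    proof
      show "P (cube c r) {(z, cube c r)}"
        unfolding P_def
      proof (intro conjI)
        show "{(z, cube c r)} tagged_division_of cube c r" using that(2) by (rule tagged_division_of_self)
        show "\<gamma> fine {(z, cube c r)}" using subset_trans[OF that(3) e(2)] by (simp add: fine_def)
      qed (simp_all add: is_cube_cube that(1))
    qed
    then show "\<exists>e>0. \<forall>c r. 0 < r \<and> z \<in> cube c r \<and> cube c r \<subseteq> ball z e \<longrightarrow> (\<exists>p. P (cube c r) p)"
      using e(1) by (intro exI[of _ e]) simp
  next
    fix c r
    assume split: "0 < r" "cube c r \<subseteq> cube a l" "\<And>s. \<exists>p. P (subcube c r s) p"
    have cr: "is_cube (cube c r)" using split by (simp add: is_cube_cube)
    have crs: "is_cube (subcube c r s)" for s using split by (simp add: is_cube_cube)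
    have fcr: "set_integrable lebesgue (cube c r) f" "set_integrable lebesgue (cube c r) (\<lambda>x. exp (f x))"
      by (rule set_integrable_subcube[OF f cr split(2)], rule set_integrable_subcube[OF e cr split(2)])
    have fs: "set_integrable lebesgue (subcube c r s) f" "set_integrable lebesgue (subcube c r s) (\<lambda>x. exp (f x))" for s
      by (rule set_integrable_subcube[OF fcr(1) crs subcube_subset[OF split(1)]],
          rule set_integrable_subcube[OF fcr(2) crs subcube_subset[OF split(1)]])
    obtain q where q: "\<And>s. P (subcube c r s) (q s)" using split(3) by metis
    have inj: "inj (subcube c r)" by (rule inj_subcube[OF split(1)])
    define p where "p = (\<Union>s. q s)"
    \<comment> \<open>\<open>tagged_division_Union\<close> takes a family indexed by the pieces
      themselves, so \<open>q\<close> is transported along the inverse of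
      \<open>subcube c r\<close>.\<close>
    have "\<Union>((q \<circ> the_inv (subcube c r)) ` range (subcube c r)) tagged_division_of \<Union>(range (subcube c r))"
    proof (rule tagged_division_Union)
      show "interior K \<inter> interior L = {}" if "K \<in> range (subcube c r)" "L \<in> range (subcube c r)" "K \<noteq> L" for K L
        using subcubes_division_of[OF split(1), of c] that by (rule division_ofD(5))
      show "(q \<circ> the_inv (subcube c r)) K tagged_division_of K" if "K \<in> range (subcube c r)" for K
        using that q by (auto simp: the_inv_f_f[OF inj] P_def)
    qed simp
    then have p1: "p tagged_division_of cube c r"
      unfolding p_def division_ofD(6)[OF subcubes_division_of[OF split(1)]]
      by (simp add: image_image the_inv_f_f[OF inj])
    have p2: "\<gamma> fine p" unfolding p_def using q by (intro fine_Union) (auto simp: P_def)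
    have p3: "\<forall>(x, K)\<in>p. is_cube K" unfolding p_def using q by (fastforce simp: P_def)
    have "(\<Sum>(x, K)\<in>p. b K) = (\<Sum>s\<in>UNIV. \<Sum>(x, K)\<in>q s. b K)"
      unfolding p_def
    proof (rule sum.UNION_disjoint)
      show "\<forall>s\<in>UNIV. finite (q s)" using q unfolding P_def by (blast dest: tagged_division_ofD(1))
      \<comment> \<open>A piece common to two children would have empty interior, which no
        nondegenerate cube has.\<close>
      show "\<forall>s\<in>UNIV. \<forall>t\<in>UNIV. s \<noteq> t \<longrightarrow> q s \<inter> q t = {}"
      proof (intro ballI impI equals0I)
        fix s t y assume st: "s \<noteq> t" "y \<in> q s \<inter> q t"
        obtain x K where y: "y = (x, K)" by (cases y)
        have "K \<subseteq> subcube c r s" "K \<subseteq> subcube c r t"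
          using st(2) q[of s] q[of t] tagged_division_ofD(3) unfolding y P_def by auto
        then have "interior K \<subseteq> interior (subcube c r s) \<inter> interior (subcube c r t)"
          by (blast dest: interior_mono)
        then have "interior K = {}" using interior_subcubes_disjoint[OF st(1), of c r] by blast
        moreover have "is_cube K" using st(2) q unfolding y P_def by blast
        ultimately show False using interior_cube_nonempty by (metis is_cubeE)
      qed
    qed simp
    also have "\<dots> \<le> (\<Sum>s\<in>UNIV. b (subcube c r s))"
      using q unfolding P_def by (intro sum_mono) blast
    also have "\<dots> = (measure lebesgue (cube c r) / 2 ^ CARD('n)) *
        (\<Sum>s\<in>UNIV. bellman d (avg (subcube c r s) f) (avg (subcube c r s) (\<lambda>x. exp (f x))))"
    proof -
      have "measure lebesgue (subcube c r s) = measure lebesgue (cube c r) / 2 ^ CARD('n)" for s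
        unfolding measure_subcube[OF split(1), of c s, symmetric] by simp
      then show ?thesis by (simp only: b_def sum_distrib_left)
    qed
    also have "\<dots> \<le> (measure lebesgue (cube c r) / 2 ^ CARD('n)) *
        (2 ^ CARD('n) * bellman d (avg (cube c r) f) (avg (cube c r) (\<lambda>x. exp (f x))))"
    proof (intro mult_left_mono sum_bellman_le)
      show "0 < avg (subcube c r s) (\<lambda>x. exp (f x))" for s
        using exp_avg_le[OF crs fs, of s] exp_gt_zero less_le_trans by blast
      show "avg (cube c r) (\<lambda>x. exp (f x)) \<le> C * exp (avg (cube c r) f)" by (rule C(2)[OF cr split(2)])
    qed (use C d sum_avg_subcubes[OF split(1) fcr(1)] sum_avg_subcubes[OF split(1) fcr(2)]
        in \<open>auto simp: card_UNIV_set\<close>)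
    also have "\<dots> = b (cube c r)" by (simp add: b_def)
    finally show "\<exists>p. P (cube c r) p" using p1 p2 p3 unfolding P_def by blast
  qed
  then show ?thesis unfolding P_def by blast
qed

section \<open>Self-improvement on a cube\<close>

text \<open>Truncation at k makes the exponential Lipschitz in its argument. This turns the
  discrepancy between f at a tag and its average over the piece into an error that Henstock's lemma
  controls.\<close>

lemma exp_truncated_diff_le:
  fixes c k u v :: real
  assumes "0 < c"
  shows "exp (c * min u k) \<le> exp (c * min v k) + c * exp (c * k) * \<bar>u - v\<bar>"
proof -
  define A B where "A = c * min u k" and "B = c * min v k"
  have "A - B \<le> c * \<bar>u - v\<bar>"
    unfolding A_def B_def right_diff_distrib[symmetric] using assms by (intro mult_left_mono) auto
  have "exp A * (1 + (B - A)) \<le> exp A * exp (B - A)" by (intro mult_left_mono exp_ge_add_one_self) auto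
  then have "exp A \<le> exp B + exp A * (A - B)" by (simp add: algebra_simps flip: exp_add)
  also have "exp A * (A - B) \<le> exp A * (c * \<bar>u - v\<bar>)"
    by (rule mult_left_mono) (fact, simp)
  also have "\<dots> \<le> exp (c * k) * (c * \<bar>u - v\<bar>)"
    unfolding A_def using assms by (intro mult_right_mono) auto
  finally show ?thesis by (simp add: A_def B_def algebra_simps)
qed

lemma set_integrable_exp_truncated:
  fixes f :: "real^'n \<Rightarrow> real"
  assumes J: "is_cube J" and f: "set_integrable lebesgue J f" and c: "0 < c"
  shows "set_integrable lebesgue J (\<lambda>x. exp (c * min (f x) k))"
proof (rule measurable_bounded_by_integrable_imp_absolutely_integrable)
  have [measurable]: "f \<in> borel_measurable (lebesgue_on J)"
    using f J by (simp add: absolutely_integrable_measurable cube_sets)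
  show "(\<lambda>x. exp (c * min (f x) k)) \<in> borel_measurable (lebesgue_on J)" by measurable
  show "(\<lambda>x. exp (c * k)) integrable_on J"
    using set_lebesgue_integral_eq_integral(1)[OF set_integrable_const_cube[OF J]] .
qed (use J c in \<open>auto simp: cube_sets\<close>)

text \<open>Approximate the integral by a Riemann sum over a fine division into cubes. At each tag
  the integrand is at most the Bellman value of the piece plus a Lipschitz error; the Bellman values
  sum to at most the value at the whole cube, and the errors are small in total. Truncation ensures
  that the integral exists beforehand.\<close>

lemma integral_exp_truncated_le:
  fixes f :: "real^'n \<Rightarrow> real"
  assumes l: "0 < l"
    and f: "set_integrable lebesgue (cube a l) f" and e: "set_integrable lebesgue (cube a l) (\<lambda>x. exp (f x))"
    and C: "1 \<le> C" "\<And>K. is_cube K \<Longrightarrow> K \<subseteq> cube a l \<Longrightarrow> avg K (\<lambda>x. exp (f x)) \<le> C * exp (avg K f)"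
    and d: "d = 1 / (16 * 2 ^ CARD('n) * C\<^sup>2)"
  shows "integral (cube a l) (\<lambda>x. exp ((1 + d) * min (f x) k))
    \<le> measure lebesgue (cube a l) * bellman d (avg (cube a l) f) (avg (cube a l) (\<lambda>x. exp (f x)))"
proof (rule field_le_epsilon)
  fix \<epsilon> :: real assume "0 < \<epsilon>"
  define c where "c = 1 + d"
  have c0: "0 < c" using C unfolding c_def d by (intro add_pos_nonneg) auto
  define g where "g x = exp (c * min (f x) k)" for x
  define L where "L = c * exp (c * k)"
  have L0: "0 < L" using c0 by (simp add: L_def)
  define b where "b K = measure lebesgue K * bellman d (avg K f) (avg K (\<lambda>x. exp (f x)))" for K
  have cub: "is_cube (cube a l)" using l by (rule is_cube_cube)
  have g: "g integrable_on cube a l"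
    unfolding g_def by (rule set_lebesgue_integral_eq_integral(1)[OF set_integrable_exp_truncated[OF cub f c0]])
  obtain \<gamma> where \<gamma>: "gauge \<gamma>" "\<And>p. p tagged_division_of (cube a l) \<Longrightarrow> \<gamma> fine p \<Longrightarrow>
      norm ((\<Sum>(x, K)\<in>p. measure lborel K *\<^sub>R g x) - integral (cube a l) g) < \<epsilon> / 2"
    using integrable_integral[OF g] \<open>0 < \<epsilon>\<close> unfolding has_integral by (metis half_gt_zero)
  \<comment> \<open>The errors enter multiplied by the Lipschitz constant \<open>L\<close>, so this
    tolerance costs another \<epsilon> / 2, beside that of the Riemann sum.\<close>
  have "0 < \<epsilon> / (2 * L)" using \<open>0 < \<epsilon>\<close> L0 by simp
  with set_lebesgue_integral_eq_integral(1)[OF f]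
  obtain \<gamma>' where \<gamma>': "gauge \<gamma>'" "\<And>p. p tagged_partial_division_of (cube a l) \<Longrightarrow> \<gamma>' fine p \<Longrightarrow>
      (\<Sum>(x, K)\<in>p. norm (measure lborel K *\<^sub>R f x - integral K f)) < \<epsilon> / (2 * L)"
    by (rule Henstock_lemma) blast
  obtain p where p: "p tagged_division_of (cube a l)" "(\<lambda>x. \<gamma> x \<inter> \<gamma>' x) fine p"
    "\<And>x K. (x, K) \<in> p \<Longrightarrow> is_cube K" "(\<Sum>(x, K)\<in>p. b K) \<le> b (cube a l)"
    using fine_cube_division_exists[OF l f e C d gauge_Int[OF \<gamma>(1) \<gamma>'(1)]] unfolding b_def by blast
  have fine: "\<gamma> fine p" "\<gamma>' fine p" using p(2) by (auto simp: fine_Int)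
  have main: "measure lborel K *\<^sub>R g x \<le> b K + L * norm (measure lborel K *\<^sub>R f x - integral K f)" if xK: "(x, K) \<in> p" for x K
  proof -
    have K: "is_cube K" "K \<subseteq> cube a l" using p(3)[OF xK] tagged_division_ofD(3)[OF p(1) xK] by blast+
    have mK: "measure lebesgue K = measure lborel K" using K(1) by (auto simp: is_cube_def)
    have cK: "0 < measure lborel K" using measure_is_cube_pos[OF K(1)] mK by simp
    have fK: "set_integrable lebesgue K f" "set_integrable lebesgue K (\<lambda>x. exp (f x))"
      by (rule set_integrable_subcube[OF f K], rule set_integrable_subcube[OF e K])
    define A where "A = avg K f"
    define E where "E = avg K (\<lambda>x. exp (f x))"
    have AE: "exp A \<le> E" unfolding A_def E_def by (rule exp_avg_le[OF K(1) fK])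
    \<comment> \<open>At the average the truncation is dropped, and Jensen's inequality leads to
      E^(1+d), the lower bound of the Bellman function.\<close>
    have "exp (c * min A k) \<le> exp (c * A)" using c0 by simp
    also have "\<dots> = exp A powr c" by (simp add: exp_powr_real mult.commute)
    also have "\<dots> \<le> E powr c" using AE c0 by (intro powr_mono2) auto
    also have "\<dots> \<le> bellman d A E" unfolding c_def by (rule bellman_bounds[OF AE])
    finally have "g x \<le> bellman d A E + L * \<bar>f x - A\<bar>"
      using exp_truncated_diff_le[OF c0, of "f x" k A] by (simp add: g_def L_def)
    then have "measure lborel K * g x \<le> measure lborel K * (bellman d A E + L * \<bar>f x - A\<bar>)"
      using cK by (intro mult_left_mono) auto
    also have "\<dots> = b K + L * \<bar>measure lborel K * (f x - A)\<bar>"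
      by (simp only: abs_mult abs_of_pos[OF cK] b_def mK A_def[symmetric] E_def[symmetric]
          distrib_left mult.left_commute)
    also have "measure lborel K * (f x - A) = measure lborel K * f x - integral K f"
      using cK by (simp add: A_def avg_eq_integral[OF fK(1)] mK right_diff_distrib)
    finally show ?thesis by simp
  qed
  have "integral (cube a l) g \<le> (\<Sum>(x, K)\<in>p. measure lborel K *\<^sub>R g x) + \<epsilon> / 2"
    using \<gamma>(2)[OF p(1) fine(1)] unfolding real_norm_def by linarith
  also have "(\<Sum>(x, K)\<in>p. measure lborel K *\<^sub>R g x) \<le> (\<Sum>(x, K)\<in>p. b K + L * norm (measure lborel K *\<^sub>R f x - integral K f))"
    using main by (intro sum_mono) auto
  also have "\<dots> = (\<Sum>(x, K)\<in>p. b K) + L * (\<Sum>(x, K)\<in>p. norm (measure lborel K *\<^sub>R f x - integral K f))"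
    by (simp add: sum.distrib sum_distrib_left case_prod_unfold)
  also have "\<dots> \<le> b (cube a l) + L * (\<epsilon> / (2 * L))"
    using p(4) \<gamma>'(2)[OF conjunct1[OF p(1)[unfolded tagged_division_of_def]] fine(2)] L0
    by (intro add_mono mult_left_mono) auto
  also have "L * (\<epsilon> / (2 * L)) = \<epsilon> / 2" using L0 by simp
  finally show "integral (cube a l) (\<lambda>x. exp ((1 + d) * min (f x) k))
    \<le> measure lebesgue (cube a l) * bellman d (avg (cube a l) f) (avg (cube a l) (\<lambda>x. exp (f x))) + \<epsilon>"
    unfolding g_def b_def c_def by simp
qed

text \<open>The bound for the truncated integrals does not depend on the truncation level, so
  monotone convergence yields both integrability and the estimate.\<close>

lemma reverse_Hoelder:
  fixes f :: "real^'n \<Rightarrow> real"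
  assumes J: "is_cube J"
    and f: "set_integrable lebesgue J f" and e: "set_integrable lebesgue J (\<lambda>x. exp (f x))"
    and C: "1 \<le> C" "\<And>K. is_cube K \<Longrightarrow> K \<subseteq> J \<Longrightarrow> avg K (\<lambda>x. exp (f x)) \<le> C * exp (avg K f)"
    and d: "d = 1 / (16 * 2 ^ CARD('n) * C\<^sup>2)"
  shows "set_integrable lebesgue J (\<lambda>x. exp ((1 + d) * f x))"
    and "avg J (\<lambda>x. exp ((1 + d) * f x)) \<le> 2 * avg J (\<lambda>x. exp (f x)) powr (1 + d)"
proof -
  obtain a l where l: "0 < l" and Jc: "J = cube a l" using J by (rule is_cubeE)
  define R where "R = measure lebesgue J * (2 * avg J (\<lambda>x. exp (f x)) powr (1 + d))"
  have c0: "0 < 1 + d" using C unfolding d by (intro add_pos_nonneg) auto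
  define g where "g k x = exp ((1 + d) * min (f x) (real k))" for k :: nat and x
  have gi: "g k integrable_on J" for k
    unfolding g_def by (rule set_lebesgue_integral_eq_integral(1)[OF set_integrable_exp_truncated[OF J f c0]])
  have gR: "integral J (g k) \<le> R" for k
  proof -
    have "integral J (g k) \<le> measure lebesgue J * bellman d (avg J f) (avg J (\<lambda>x. exp (f x)))"
      unfolding g_def Jc using l f e C d unfolding Jc by (rule integral_exp_truncated_le)
    also have "\<dots> \<le> R" unfolding R_def
      by (intro mult_left_mono bellman_bounds(2) exp_avg_le J f e) auto
    finally show ?thesis .
  qed
  have mono: "g k x \<le> g (Suc k) x" for k x
    unfolding g_def using c0 by simp
  have lim: "(\<lambda>k. g k x) \<longlonglongrightarrow> exp ((1 + d) * f x)" for x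
  proof (rule tendsto_eventually)
    obtain N where "f x \<le> real N" using real_arch_simple by blast
    then show "\<forall>\<^sub>F k in sequentially. g k x = exp ((1 + d) * f x)"
      by (intro eventually_sequentiallyI[of N]) (auto simp: g_def min_def)
  qed
  have bd: "bounded (range (\<lambda>k. integral J (g k)))"
  proof (rule boundedI)
    fix y assume "y \<in> range (\<lambda>k. integral J (g k))"
    then obtain k where k: "y = integral J (g k)" by blast
    have "0 \<le> integral J (g k)" by (intro integral_nonneg gi) (simp add: g_def)
    then show "norm y \<le> R" using k gR[of k] by simp
  qed
  have H: "(\<lambda>x. exp ((1 + d) * f x)) integrable_on J"
    "(\<lambda>k. integral J (g k)) \<longlonglongrightarrow> integral J (\<lambda>x. exp ((1 + d) * f x))"
    using monotone_convergence_increasing[OF gi mono lim bd] by blast+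
  show I: "set_integrable lebesgue J (\<lambda>x. exp ((1 + d) * f x))"
    using H(1) by (rule nonnegative_absolutely_integrable_1) simp
  have "integral J (\<lambda>x. exp ((1 + d) * f x)) \<le> R" using H(2) gR by (intro LIMSEQ_le_const2) auto
  then show "avg J (\<lambda>x. exp ((1 + d) * f x)) \<le> 2 * avg J (\<lambda>x. exp (f x)) powr (1 + d)"
    unfolding avg_eq_integral[OF I] R_def using measure_is_cube_pos[OF J] by (simp add: pos_divide_le_eq mult.commute)
qed

section \<open>Exponential ratios on a cube\<close>

lemma cubes_inD:
  assumes "J \<in> cubes_in X" shows "is_cube J" "J \<subseteq> X"
  using assms by (auto simp: cubes_in_def)

lemma bounded_subset_cube:
  fixes K :: "(real^'n) set"
  assumes "bounded K" obtains r where "0 < r" "K \<subseteq> cube (- vec r) (2 * r)"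
proof -
  obtain r where r: "0 < r" "\<And>x. x \<in> K \<Longrightarrow> norm x \<le> r" using assms by (auto simp: bounded_pos)
  have "K \<subseteq> cube (- vec r) (2 * r)"
  proof
    fix x assume "x \<in> K"
    then have "\<bar>x $ i\<bar> \<le> r" for i using r(2) component_le_norm_cart order_trans by blast
    then show "x \<in> cube (- vec r) (2 * r)" unfolding mem_cube by (auto simp: abs_le_iff minus_le_iff)
  qed
  with r(1) show ?thesis by (rule that)
qed

lemma compact_subset_cubes_in:
  assumes "X = UNIV \<or> is_cube X" "compact K" "K \<subseteq> X"
  obtains J where "J \<in> cubes_in X" "K \<subseteq> J"
proof (cases "X = UNIV")
  case True
  obtain r where r: "0 < r" "K \<subseteq> cube (- vec r) (2 * r)"
    using bounded_subset_cube compact_imp_bounded assms(2) by blast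
  then have "cube (- vec r) (2 * r) \<in> cubes_in X"
    unfolding cubes_in_def True using is_cube_cube[of "2 * r" "- vec r"] by (auto simp del: add_uminus_conv_diff)
  then show ?thesis using r(2) by (rule that)
next
  case False
  then show ?thesis using that[of X] assms by (simp add: cubes_in_def)
qed

text \<open>Cubes are compact, and every compact subset of X lies in a cube contained in X.\<close>

lemma locally_integrable_on_iff_cubes:
  assumes "X = UNIV \<or> is_cube X"
  shows "locally_integrable_on f X \<longleftrightarrow> (\<forall>J\<in>cubes_in X. set_integrable lebesgue J f)"
proof
  assume "locally_integrable_on f X"
  then show "\<forall>J\<in>cubes_in X. set_integrable lebesgue J f"
    unfolding locally_integrable_on_def by (metis cubes_inD is_cubeE compact_cbox)
next
  assume *: "\<forall>J\<in>cubes_in X. set_integrable lebesgue J f"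
  show "locally_integrable_on f X"
    unfolding locally_integrable_on_def
  proof (intro allI impI)
    fix K assume K: "compact K \<and> K \<subseteq> X"
    then obtain J where "J \<in> cubes_in X" "K \<subseteq> J" using compact_subset_cubes_in assms by metis
    then show "set_integrable lebesgue K f"
      using * K by (meson set_integrable_subset lmeasurable_compact fmeasurableD)
  qed
qed

lemma avg_eq_const_AE:
  assumes J: "is_cube J" and f: "set_integrable lebesgue J f" and c: "AE x in lebesgue. x \<in> J \<longrightarrow> f x = c"
  shows "avg J f = c"
proof -
  have "(LINT x:J|lebesgue. f x) = (LINT x:J|lebesgue. c)"
    unfolding set_lebesgue_integral_def
  proof (rule integral_cong_AE)
    show "(\<lambda>x. indicat_real J x *\<^sub>R f x) \<in> borel_measurable lebesgue"
      using f unfolding set_integrable_def by (rule borel_measurable_integrable)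
    show "AE x in lebesgue. indicat_real J x *\<^sub>R f x = indicat_real J x *\<^sub>R c"
      using c by eventually_elim (auto simp: indicator_def)
  qed (use cube_sets[OF J] in measurable)
  then show ?thesis using avg_const[OF J, of c] by (simp add: avg_def)
qed

text \<open>If X is the whole space, it is a countable union of cubes \<open>Q k\<close> containing
  \<open>Q 0\<close>. Were f constant a.e. on each, every constant would be the average over
  \<open>Q 0\<close>, so f would be constant a.e. on X.\<close>

lemma exists_nonconstant_cube:
  fixes f :: "real^'n \<Rightarrow> real"
  assumes X: "X = UNIV \<or> is_cube X" and f: "\<And>J. J \<in> cubes_in X \<Longrightarrow> set_integrable lebesgue J f"
    and nc: "\<not> (\<exists>c. AE x in lebesgue. x \<in> X \<longrightarrow> f x = c)"
  obtains J where "J \<in> cubes_in X" "\<not> (\<exists>c. AE x in lebesgue. x \<in> J \<longrightarrow> f x = c)"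
proof (cases "X = UNIV")
  case True
  define Q where "Q k = cube (- vec (real (Suc k)) :: real^'n) (2 * real (Suc k))" for k :: nat
  have Q: "is_cube (Q k)" for k unfolding Q_def by (rule is_cube_cube) simp
  then have QX: "Q k \<in> cubes_in X" for k using True by (simp add: cubes_in_def)
  have Q0: "Q 0 \<subseteq> Q k" for k
    unfolding Q_def
  proof (rule subsetI, unfold mem_cube, rule allI)
    fix x i assume "\<forall>i. (- vec (real (Suc 0))) $ i \<le> x $ i \<and> x $ i \<le> (- vec (real (Suc 0))) $ i + 2 * real (Suc 0)"
    then have "(- vec (real (Suc 0))) $ i \<le> x $ i \<and> x $ i \<le> (- vec (real (Suc 0))) $ i + 2 * real (Suc 0)" ..
    then show "(- vec (real (Suc k))) $ i \<le> x $ i \<and> x $ i \<le> (- vec (real (Suc k))) $ i + 2 * real (Suc k)"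
      by simp
  qed
  have cov: "\<exists>k. x \<in> Q k" for x
  proof -
    obtain k where k: "norm x \<le> real k" using real_arch_simple by blast
    have "x \<in> Q k" unfolding Q_def mem_cube
    proof
      fix i have "\<bar>x $ i\<bar> \<le> real k" using component_le_norm_cart[of x i] k by linarith
      then show "(- vec (real (Suc k))) $ i \<le> x $ i \<and> x $ i \<le> (- vec (real (Suc k))) $ i + 2 * real (Suc k)"
        by auto
    qed
    then show ?thesis ..
  qed
  show ?thesis
  proof (rule ccontr)
    assume "\<not> thesis"
    then have "\<exists>c. AE x in lebesgue. x \<in> Q k \<longrightarrow> f x = c" for k using that QX by blast
    then obtain c where c: "\<And>k. AE x in lebesgue. x \<in> Q k \<longrightarrow> f x = c k" by metis
    have eq: "c k = avg (Q 0) f" for k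
    proof -
      have "AE x in lebesgue. x \<in> Q 0 \<longrightarrow> f x = c k"
        using c[of k] by eventually_elim (use Q0[of k] in blast)
      then show ?thesis using avg_eq_const_AE[OF Q f[OF QX]] by metis
    qed
    have "AE x in lebesgue. \<forall>k. x \<in> Q k \<longrightarrow> f x = avg (Q 0) f"
      using c unfolding eq AE_all_countable by blast
    then have "AE x in lebesgue. x \<in> X \<longrightarrow> f x = avg (Q 0) f"
      by eventually_elim (use cov in blast)
    then show False using nc by blast
  qed
next
  case False
  then show ?thesis using that[of X] X nc by (simp add: cubes_in_def)
qed

section \<open>The ratio as a function of the exponent\<close>

definition exp_ratio :: "(real^'n \<Rightarrow> real) \<Rightarrow> (real^'n) set \<Rightarrow> real \<Rightarrow> real" where
  "exp_ratio f J t = avg J (\<lambda>x. exp (t * f x)) * exp (- (t * avg J f))"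

lemma F_fun_eq: "F_fun X f t = (SUP J\<in>cubes_in X. exp_ratio f J t)"
  by (simp add: F_fun_def A_infty_const_def exp_ratio_def avg_cmult)

lemma exp_ratio_ge_1:
  assumes "is_cube J" "set_integrable lebesgue J f" "set_integrable lebesgue J (\<lambda>x. exp (t * f x))"
  shows "1 \<le> exp_ratio f J t"
proof -
  have "exp (t * avg J f) \<le> avg J (\<lambda>x. exp (t * f x))"
    using exp_avg_le[of J "\<lambda>x. t * f x"] assms by (simp add: avg_cmult)
  then show ?thesis by (simp add: exp_ratio_def exp_minus field_simps)
qed

text \<open>The equality case of Jensen's inequality: with u = t * (f - A), the function h = exp u -
  1 - u is nonnegative and has mean ratio - 1. If that mean is not positive, then h = 0 a.e., hence
  u = 0 a.e.\<close>

lemma exp_ratio_gt_1: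
  assumes J: "is_cube J" and f: "set_integrable lebesgue J f"
    and e: "set_integrable lebesgue J (\<lambda>x. exp (t * f x))"
    and t: "t \<noteq> 0" and nc: "\<not> (\<exists>c. AE x in lebesgue. x \<in> J \<longrightarrow> f x = c)"
  shows "1 < exp_ratio f J t"
proof (rule ccontr)
  assume neg: "\<not> 1 < exp_ratio f J t"
  define A where "A = avg J f"
  \<comment> \<open>Written as a combination of exp (t * f), f and a constant, so that integrability
    and the average are immediate; \<open>h_eq\<close> gives the form that shows the sign.\<close>
  define h where "h x = exp (- (t * A)) * exp (t * f x) + (- t * f x + (t * A - 1))" for x
  have h_eq: "h x = exp (t * (f x - A)) - 1 - t * (f x - A)" for x
    by (simp add: h_def algebra_simps flip: exp_add)
  have i: "set_integrable lebesgue J (\<lambda>x. exp (- (t * A)) * exp (t * f x))"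
    "set_integrable lebesgue J (\<lambda>x. - t * f x)" "set_integrable lebesgue J (\<lambda>x. t * A - 1)"
    using e f by (intro set_integrable_mult_right set_integrable_const_cube[OF J]; blast)+
  have ih: "set_integrable lebesgue J h" unfolding h_def by (intro set_integral_add i)
  have "avg J h = exp (- (t * A)) * avg J (\<lambda>x. exp (t * f x)) + (- t * A + (t * A - 1))"
    unfolding h_def
    by (subst avg_add[OF i(1) set_integral_add(1)[OF i(2,3)]], subst avg_add[OF i(2,3)])
      (simp only: avg_cmult avg_const[OF J] A_def)
  also have "\<dots> = exp_ratio f J t - 1" by (simp add: exp_ratio_def A_def mult.commute)
  finally have "avg J h \<le> 0" using neg by simp
  then have "(LINT x:J|lebesgue. h x) \<le> 0"
    using measure_is_cube_pos[OF J] by (simp add: avg_def divide_le_0_iff)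
  moreover have h0: "0 \<le> h x" for x
    unfolding h_eq using exp_ge_add_one_self[of "t * (f x - A)"] by linarith
  ultimately have "(LINT x|lebesgue. indicat_real J x *\<^sub>R h x) = 0"
    unfolding set_lebesgue_integral_def by (intro antisym integral_nonneg_AE) auto
  then have "AE x in lebesgue. indicat_real J x *\<^sub>R h x = 0"
    using integral_nonneg_eq_0_iff_AE[OF ih[unfolded set_integrable_def]] h0 by auto
  then have "AE x in lebesgue. x \<in> J \<longrightarrow> f x = A"
  proof eventually_elim
    case (elim x)
    show ?case
    proof
      assume "x \<in> J"
      then have "exp (t * (f x - A)) - 1 = t * (f x - A)" using elim by (simp add: h_eq)
      then have "exp (t * (f x - A)) = 1" by (intro ln_eq_minus_one) auto
      then show "f x = A" using t by simp
    qed
  qed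
  then show False using nc by blast
qed

lemma set_integrable_exp_between:
  fixes f :: "real^'n \<Rightarrow> real"
  assumes J: "is_cube J" and f: "set_integrable lebesgue J f"
    and e: "set_integrable lebesgue J (\<lambda>x. exp (b * f x))" and a: "0 \<le> a" "a \<le> b"
  shows "set_integrable lebesgue J (\<lambda>x. exp (a * f x))"
proof (rule measurable_bounded_by_integrable_imp_absolutely_integrable)
  have [measurable]: "f \<in> borel_measurable (lebesgue_on J)"
    using f J by (simp add: absolutely_integrable_measurable cube_sets)
  show "(\<lambda>x. exp (a * f x)) \<in> borel_measurable (lebesgue_on J)" by measurable
  show "(\<lambda>x. 1 + exp (b * f x)) integrable_on J"
    by (intro set_lebesgue_integral_eq_integral(1) set_integral_add set_integrable_const_cube J e)
  show "norm (exp (a * f x)) \<le> 1 + exp (b * f x)" for x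
  proof (cases "0 \<le> f x")
    case True
    then have "a * f x \<le> b * f x" using a by (intro mult_right_mono)
    then have "exp (a * f x) \<le> exp (b * f x)" by simp
    then show ?thesis unfolding real_norm_def abs_exp_cancel by linarith
  next
    case False
    then have "a * f x \<le> 0" using a by (simp add: mult_nonneg_nonpos)
    then have "exp (a * f x) \<le> 1" by simp
    then show ?thesis unfolding real_norm_def abs_exp_cancel using exp_gt_zero[of "b * f x"] by linarith
  qed
qed (use cube_sets[OF J] in auto)

text \<open>Hoelder's inequality for exponential moments; the remaining term of the logarithm is
  linear in the exponent. After division by the moments \<open>M a\<close> and \<open>M b\<close>,
  pointwise convexity of exp gives a majorant of average 1.\<close>

lemma ln_exp_ratio_convex:
  assumes J: "is_cube J" and f: "set_integrable lebesgue J f" and t: "0 \<le> t" "t \<le> 1"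
    and e: "set_integrable lebesgue J (\<lambda>x. exp (a * f x))" "set_integrable lebesgue J (\<lambda>x. exp (b * f x))"
      "set_integrable lebesgue J (\<lambda>x. exp (((1 - t) * a + t * b) * f x))"
  shows "ln (exp_ratio f J ((1 - t) * a + t * b)) \<le> (1 - t) * ln (exp_ratio f J a) + t * ln (exp_ratio f J b)"
proof -
  define c where "c = (1 - t) * a + t * b"
  define M where "M s = avg J (\<lambda>x. exp (s * f x))" for s
  have Mpos: "0 < M s" if "set_integrable lebesgue J (\<lambda>x. exp (s * f x))" for s
    unfolding M_def using f that
    by (intro less_le_trans[OF exp_gt_zero exp_avg_le[OF J]] set_integrable_mult_right) auto
  have lnr: "ln (exp_ratio f J s) = ln (M s) - s * avg J f" if "set_integrable lebesgue J (\<lambda>x. exp (s * f x))" for s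
    using Mpos[OF that] by (simp add: exp_ratio_def M_def ln_mult)
  define \<alpha> where "\<alpha> = (1 - t) * ln (M a) + t * ln (M b)"
  have i: "set_integrable lebesgue J (\<lambda>x. (1 - t) / M a * exp (a * f x))"
    "set_integrable lebesgue J (\<lambda>x. t / M b * exp (b * f x))"
    "set_integrable lebesgue J (\<lambda>x. exp (- \<alpha>) * exp (c * f x))"
    using e by (auto simp: c_def)
  have "exp (- \<alpha>) * M c = avg J (\<lambda>x. exp (- \<alpha>) * exp (c * f x))" by (simp only: M_def avg_cmult)
  also have "\<dots> \<le> avg J (\<lambda>x. (1 - t) / M a * exp (a * f x) + t / M b * exp (b * f x))"
  proof (rule avg_mono)
    fix x
    define u v where "u = a * f x - ln (M a)" and "v = b * f x - ln (M b)"
    have "exp (- \<alpha>) * exp (c * f x) = exp ((1 - t) *\<^sub>R u + t *\<^sub>R v)"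
      by (simp add: \<alpha>_def c_def u_def v_def algebra_simps flip: exp_add)
    also have "\<dots> \<le> (1 - t) * exp u + t * exp v"
      using t by (intro convex_onD[OF exp_convex]) auto
    also have "\<dots> = (1 - t) / M a * exp (a * f x) + t / M b * exp (b * f x)"
      using Mpos[OF e(1)] Mpos[OF e(2)] by (simp add: u_def v_def exp_diff)
    finally show "exp (- \<alpha>) * exp (c * f x) \<le> (1 - t) / M a * exp (a * f x) + t / M b * exp (b * f x)" .
  qed (intro i set_integral_add)+
  also have "\<dots> = (1 - t) / M a * M a + t / M b * M b"
    by (subst avg_add[OF i(1,2)]) (simp only: avg_cmult M_def)
  also have "\<dots> = 1" using Mpos[OF e(1)] Mpos[OF e(2)] by simp
  finally have "M c \<le> exp \<alpha>" by (simp add: exp_minus field_simps)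
  then have "ln (M c) \<le> \<alpha>" using Mpos[of c] e(3) by (metis c_def ln_exp ln_le_cancel_iff exp_gt_zero)
  then show ?thesis unfolding lnr[OF e(1)] lnr[OF e(2)] lnr[OF e(3)] by (simp add: \<alpha>_def c_def algebra_simps)
qed

section \<open>The function F\<close>

locale exponential_weights =
  fixes X :: "(real^'n) set" and \<phi> :: "real^'n \<Rightarrow> real"
  assumes X: "X = UNIV \<or> is_cube X"
    and locint: "locally_integrable_on \<phi> X"
    and nonconst: "\<not> (\<exists>c. AE x in lebesgue. x \<in> X \<longrightarrow> \<phi> x = c)"
begin

section \<open>Admissible exponents and convexity of ln F\<close>

definition admissible :: "real set" where
  "admissible = {t. (\<lambda>x. exp (t * \<phi> x)) \<in> A_infty X}"

lemma integrable: "J \<in> cubes_in X \<Longrightarrow> set_integrable lebesgue J \<phi>"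
  using locint X by (simp add: locally_integrable_on_iff_cubes)

lemma cubes_nonempty: "cubes_in X \<noteq> {}"
  using exists_nonconstant_cube[OF X integrable nonconst] by blast

lemma admissible_iff:
  "t \<in> admissible \<longleftrightarrow> (\<forall>J\<in>cubes_in X. set_integrable lebesgue J (\<lambda>x. exp (t * \<phi> x)))
    \<and> bdd_above ((\<lambda>J. exp_ratio \<phi> J t) ` cubes_in X)"
proof -
  have "\<forall>J\<in>cubes_in X. set_integrable lebesgue J (\<lambda>x. t * \<phi> x)" using integrable by simp
  then show ?thesis
    by (simp add: admissible_def A_infty_def locally_integrable_on_iff_cubes[OF X] exp_ratio_def avg_cmult)
qed

lemma admissible_integrable:
  "t \<in> admissible \<Longrightarrow> J \<in> cubes_in X \<Longrightarrow> set_integrable lebesgue J (\<lambda>x. exp (t * \<phi> x))"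
  by (simp add: admissible_iff)

lemma exp_ratio_le_F: "t \<in> admissible \<Longrightarrow> J \<in> cubes_in X \<Longrightarrow> exp_ratio \<phi> J t \<le> F_fun X \<phi> t"
  unfolding F_fun_eq admissible_iff by (intro cSUP_upper) auto

lemma one_le_exp_ratio: "t \<in> admissible \<Longrightarrow> J \<in> cubes_in X \<Longrightarrow> 1 \<le> exp_ratio \<phi> J t"
  by (intro exp_ratio_ge_1 integrable admissible_integrable cubes_inD)

lemma one_le_F: "t \<in> admissible \<Longrightarrow> 1 \<le> F_fun X \<phi> t"
  using cubes_nonempty one_le_exp_ratio exp_ratio_le_F by (meson ex_in_conv order_trans)

lemma exp_ratio_0: "J \<in> cubes_in X \<Longrightarrow> exp_ratio \<phi> J 0 = 1"
  by (simp add: exp_ratio_def avg_const cubes_inD)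

lemma zero_admissible: "0 \<in> admissible"
  unfolding admissible_iff
  by (auto simp: exp_ratio_0 set_integrable_const_cube cubes_inD intro!: bdd_aboveI[of _ 1])

lemma F_0: "F_fun X \<phi> 0 = 1"
  unfolding F_fun_eq using cubes_nonempty by (simp add: exp_ratio_0)

lemma one_less_F:
  assumes "t \<in> admissible" "t \<noteq> 0" shows "1 < F_fun X \<phi> t"
proof -
  obtain J where J: "J \<in> cubes_in X" "\<not> (\<exists>c. AE x in lebesgue. x \<in> J \<longrightarrow> \<phi> x = c)"
    using exists_nonconstant_cube[OF X integrable nonconst] by blast
  have "1 < exp_ratio \<phi> J t"
    using J(2) assms by (intro exp_ratio_gt_1 cubes_inD[OF J(1)] integrable[OF J(1)] admissible_integrable[OF _ J(1)])
  also have "\<dots> \<le> F_fun X \<phi> t" by (rule exp_ratio_le_F[OF assms(1) J(1)])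
  finally show ?thesis .
qed

lemma exp_ratio_interpolate:
  assumes ab: "a \<in> admissible" "b \<in> admissible" "0 \<le> a" "0 \<le> b" and t: "0 \<le> t" "t \<le> 1"
    and J: "J \<in> cubes_in X"
  shows "set_integrable lebesgue J (\<lambda>x. exp (((1 - t) * a + t * b) * \<phi> x))"
    and "ln (exp_ratio \<phi> J ((1 - t) * a + t * b)) \<le> (1 - t) * ln (F_fun X \<phi> a) + t * ln (F_fun X \<phi> b)"
proof -
  note [simp] = cubes_inD(1)[OF J] integrable[OF J]
  \<comment> \<open>Integrability at the intermediate exponent is inherited from the larger
    endpoint, since exp (s * f) <= 1 + exp (b * f) for 0 <= s <= b.\<close>
  have m: "max a b \<in> admissible" using ab by (simp add: max_def)
  have "(1 - t) * a + t * b \<le> (1 - t) * max a b + t * max a b"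
    using t by (intro add_mono mult_left_mono) auto
  then have "(1 - t) * a + t * b \<le> max a b" by (simp add: algebra_simps)
  then show *: "set_integrable lebesgue J (\<lambda>x. exp (((1 - t) * a + t * b) * \<phi> x))"
    using ab t by (intro set_integrable_exp_between[OF _ _ admissible_integrable[OF m J]]) auto
  have "ln (exp_ratio \<phi> J ((1 - t) * a + t * b)) \<le> (1 - t) * ln (exp_ratio \<phi> J a) + t * ln (exp_ratio \<phi> J b)"
    using t ab J * by (intro ln_exp_ratio_convex) (auto intro: admissible_integrable)
  also have "\<dots> \<le> (1 - t) * ln (F_fun X \<phi> a) + t * ln (F_fun X \<phi> b)"
  proof -
    have "ln (exp_ratio \<phi> J s) \<le> ln (F_fun X \<phi> s)" if "s \<in> admissible" for s
      using one_le_exp_ratio[OF that J] exp_ratio_le_F[OF that J] by simp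
    then show ?thesis using ab t by (intro add_mono mult_left_mono) auto
  qed
  finally show "ln (exp_ratio \<phi> J ((1 - t) * a + t * b)) \<le> (1 - t) * ln (F_fun X \<phi> a) + t * ln (F_fun X \<phi> b)" .
qed

text \<open>A supremum of convex functions is convex. The same uniform bound exp ?R first shows that
  the supremum at the intermediate exponent is finite.\<close>

lemma admissible_convex:
  assumes ab: "a \<in> admissible" "b \<in> admissible" "0 \<le> a" "0 \<le> b" and t: "0 \<le> t" "t \<le> 1"
  shows "(1 - t) * a + t * b \<in> admissible"
    and "ln (F_fun X \<phi> ((1 - t) * a + t * b)) \<le> (1 - t) * ln (F_fun X \<phi> a) + t * ln (F_fun X \<phi> b)"
      (is "_ \<le> ?R")
proof -
  let ?c = "(1 - t) * a + t * b"
  have le: "exp_ratio \<phi> J ?c \<le> exp ?R" if J: "J \<in> cubes_in X" for J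
  proof -
    have "1 \<le> exp_ratio \<phi> J ?c"
      using exp_ratio_interpolate(1)[OF assms J] by (intro exp_ratio_ge_1 cubes_inD[OF J] integrable[OF J])
    then show ?thesis
      using exp_ratio_interpolate(2)[OF assms J] by (subst ln_le_cancel_iff[symmetric]) auto
  qed
  show c: "?c \<in> admissible"
    unfolding admissible_iff using exp_ratio_interpolate(1)[OF assms] le
    by (auto intro!: bdd_aboveI[of _ "exp ?R"])
  have "F_fun X \<phi> ?c \<le> exp ?R" by (subst F_fun_eq) (intro cSUP_least cubes_nonempty le)
  then show "ln (F_fun X \<phi> ?c) \<le> ?R"
    using one_le_F[OF c] by (subst ln_exp[of ?R, symmetric], subst ln_le_cancel_iff) auto
qed

text \<open>Convexity with left endpoint 0, where ln F vanishes: ln F(t) / t does not decrease.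
  Monotonicity, continuity at 0 and growth at infinity all come from this.\<close>

lemma F_scale:
  assumes "b \<in> admissible" "0 \<le> a" "a \<le> b" "0 < b"
  shows "a \<in> admissible" "ln (F_fun X \<phi> a) \<le> a / b * ln (F_fun X \<phi> b)"
  using admissible_convex[OF zero_admissible assms(1), of "a / b"] assms by (auto simp: F_0)

section \<open>Monotonicity and continuity on the half-open interval\<close>

definition domain :: "real set" where
  "domain = {t. 0 \<le> t \<and> ereal t < eps_crit X \<phi>}"

text \<open>Below the supremum there is always a larger admissible exponent, from which
  \<open>F_scale\<close> descends.\<close>

lemma domain_admissible:
  assumes "a \<in> domain" shows "a \<in> admissible"
proof -
  have "0 \<le> a" "ereal a < eps_crit X \<phi>" using assms by (auto simp: domain_def)
  then obtain b where "0 < b" "b \<in> admissible" "a < b"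
    by (auto simp: eps_crit_def less_Sup_iff admissible_def)
  then show ?thesis using F_scale(1)[of b a] \<open>0 \<le> a\<close> by simp
qed

text \<open>ln F(a) <= (a / b) * ln F(b) with a / b < 1, and ln F(b) > 0 because \<phi> is not
  constant.\<close>

lemma F_strict_mono: "strict_mono_on domain (F_fun X \<phi>)"
proof (rule strict_mono_onI)
  fix a b assume ab: "a \<in> domain" "b \<in> domain" "a < b"
  have a: "0 \<le> a" using ab by (simp add: domain_def)
  note adm = domain_admissible[OF ab(1)] domain_admissible[OF ab(2)]
  have "1 < F_fun X \<phi> b" using one_less_F[OF adm(2)] a ab by simp
  then have "0 < ln (F_fun X \<phi> b)" by simp
  have "ln (F_fun X \<phi> a) \<le> a / b * ln (F_fun X \<phi> b)" using F_scale(2)[OF adm(2) a] ab a by simp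
  also have "\<dots> < 1 * ln (F_fun X \<phi> b)"
    using \<open>0 < ln (F_fun X \<phi> b)\<close> a ab by (intro mult_strict_right_mono) auto
  finally have "ln (F_fun X \<phi> a) < ln (F_fun X \<phi> b)" by simp
  then show "F_fun X \<phi> a < F_fun X \<phi> b"
    using one_le_F[OF adm(1)] one_le_F[OF adm(2)] by (subst (asm) ln_less_cancel_iff) auto
qed

lemma ln_F_continuous: "continuous_on domain (\<lambda>t. ln (F_fun X \<phi> t))"
proof -
  let ?H = "\<lambda>t. ln (F_fun X \<phi> t)"
  have conv: "convex domain"
    unfolding convex_alt
  proof (intro ballI allI impI)
    fix a b u :: real assume *: "a \<in> domain" "b \<in> domain" "0 \<le> u \<and> u \<le> 1"
    have "(1 - u) * a + u * b \<le> (1 - u) * max a b + u * max a b"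
      using * by (intro add_mono mult_left_mono) auto
    then have "ereal ((1 - u) * a + u * b) \<le> ereal (max a b)"
      unfolding ereal_less_eq by (simp add: algebra_simps)
    also have "\<dots> < eps_crit X \<phi>" using * by (simp add: domain_def max_def)
    finally show "(1 - u) *\<^sub>R a + u *\<^sub>R b \<in> domain"
      using * by (simp add: domain_def)
  qed
  have "open (domain \<inter> {0<..})"
  proof -
    have "domain \<inter> {0<..} = {0<..} \<inter> ereal -` {..<eps_crit X \<phi>}" by (auto simp: domain_def)
    then show ?thesis by (simp add: open_Int open_ereal_vimage)
  qed
  moreover have "convex_on (domain \<inter> {0<..}) ?H"
    using conv domain_admissible admissible_convex(2)
    by (intro convex_onI convex_Int) (auto simp: domain_def)
  ultimately have int: "continuous_on (domain \<inter> {0<..}) ?H" by (rule convex_on_continuous)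
  show ?thesis
    unfolding continuous_on_eq_continuous_within
  proof
    fix x assume x: "x \<in> domain"
    show "continuous (at x within domain) ?H"
    proof (cases "x = 0")
      case False
      then have "x \<in> domain \<inter> {0<..}" using x by (auto simp: domain_def)
      then have "isCont ?H x" using int \<open>open (domain \<inter> {0<..})\<close> by (simp add: continuous_on_eq_continuous_at)
      then show ?thesis by (rule continuous_at_imp_continuous_at_within)
    next
      \<comment> \<open>A convex function may jump at an endpoint, so 0 is treated apart: ln F(t) is
        squeezed between 0 and (t / b) * ln F(b).\<close>
      case True
      then obtain b where b: "0 < b" "b \<in> admissible"
        using x by (auto simp: domain_def eps_crit_def less_Sup_iff admissible_def)
      have "(?H \<longlongrightarrow> 0) (at 0 within domain)"
      proof (rule tendsto_sandwich)
        show "\<forall>\<^sub>F t in at 0 within domain. 0 \<le> ?H t"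
          using one_le_F domain_admissible by (auto simp: eventually_at_filter intro: always_eventually)
        have "\<forall>\<^sub>F t in at 0 within domain. t < b"
          by (rule order_tendstoD(2)[OF tendsto_ident_at b(1)])
        moreover have "\<forall>\<^sub>F t in at 0 within domain. t \<in> domain"
          by (simp add: eventually_at_filter)
        ultimately show "\<forall>\<^sub>F t in at 0 within domain. ?H t \<le> t / b * ?H b"
          by eventually_elim (use F_scale(2)[OF b(2) _ _ b(1)] in \<open>auto simp: domain_def\<close>)
        have "((\<lambda>t. t / b * ?H b) \<longlongrightarrow> 0 / b * ?H b) (at 0 within domain)"
          using b by (intro tendsto_intros) auto
        then show "((\<lambda>t. t / b * ?H b) \<longlongrightarrow> 0) (at 0 within domain)" by simp
      qed simp
      then show ?thesis unfolding True by (simp add: continuous_within F_0)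
    qed
  qed
qed

lemma F_continuous: "continuous_on domain (F_fun X \<phi>)"
proof -
  have "continuous_on domain (\<lambda>t. exp (ln (F_fun X \<phi> t)))"
    by (intro continuous_on_exp ln_F_continuous)
  moreover have "exp (ln (F_fun X \<phi> t)) = F_fun X \<phi> t" if "t \<in> domain" for t
    using one_le_F[OF domain_admissible[OF that]] by simp
  ultimately show ?thesis by (subst (asm) continuous_on_cong[OF refl]) auto
qed

section \<open>Blow-up at the critical exponent\<close>

text \<open>The reverse Hoelder inequality for b * \<phi> bounds the ratio at (1 + d) * b by 2 *
  C^(1+d) on every cube, since the normalising exponentials cancel. The gain d depends on b only
  through the bound \<open>C\<close>.\<close>

lemma admissible_improve:
  assumes b: "b \<in> admissible" "F_fun X \<phi> b \<le> C" and d: "d = 1 / (16 * 2 ^ CARD('n) * C\<^sup>2)"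
  shows "(1 + d) * b \<in> admissible"
proof -
  have C: "1 \<le> C" using one_le_F[OF b(1)] b(2) by simp
  have d0: "0 < d" using C unfolding d by simp
  have main: "set_integrable lebesgue J (\<lambda>x. exp ((1 + d) * (b * \<phi> x)))"
      "exp_ratio \<phi> J ((1 + d) * b) \<le> 2 * C powr (1 + d)" if J: "J \<in> cubes_in X" for J
  proof -
    note Jc = cubes_inD[OF J]
    have i: "set_integrable lebesgue J (\<lambda>x. b * \<phi> x)" "set_integrable lebesgue J (\<lambda>x. exp (b * \<phi> x))"
      using integrable[OF J] admissible_integrable[OF b(1) J] by auto
    have r: "avg K (\<lambda>x. exp (b * \<phi> x)) \<le> C * exp (avg K (\<lambda>x. b * \<phi> x))" if "is_cube K" "K \<subseteq> J" for K
    proof -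
      have "K \<in> cubes_in X" using that Jc by (auto simp: cubes_in_def)
      then have "exp_ratio \<phi> K b \<le> C" using exp_ratio_le_F b order_trans by blast
      then show ?thesis by (simp add: exp_ratio_def exp_minus avg_cmult field_simps)
    qed
    note RH = reverse_Hoelder[OF Jc(1) i C r d]
    show "set_integrable lebesgue J (\<lambda>x. exp ((1 + d) * (b * \<phi> x)))" by (rule RH(1))
    define E where "E = avg J (\<lambda>x. exp (b * \<phi> x))"
    have E: "E \<le> C * exp (b * avg J \<phi>)" using r[OF Jc(1)] by (simp add: E_def avg_cmult)
    have E0: "0 < E" unfolding E_def by (rule less_le_trans[OF exp_gt_zero exp_avg_le[OF Jc(1) i]])
    have "avg J (\<lambda>x. exp ((1 + d) * (b * \<phi> x))) \<le> 2 * E powr (1 + d)" using RH(2) by (simp add: E_def)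
    also have "\<dots> \<le> 2 * (C * exp (b * avg J \<phi>)) powr (1 + d)"
      using E E0 d0 by (intro mult_left_mono powr_mono2) auto
    also have "\<dots> = 2 * C powr (1 + d) * exp ((1 + d) * b * avg J \<phi>)"
      using C by (simp add: powr_mult exp_powr_real mult_ac)
    finally have "exp_ratio \<phi> J ((1 + d) * b)
        \<le> 2 * C powr (1 + d) * exp ((1 + d) * b * avg J \<phi>) * exp (- ((1 + d) * b * avg J \<phi>))"
      unfolding exp_ratio_def mult.assoc[of "1 + d" b] by (intro mult_right_mono) auto
    also have "\<dots> = 2 * C powr (1 + d)" by (simp only: mult.assoc flip: exp_add) simp
    finally show "exp_ratio \<phi> J ((1 + d) * b) \<le> 2 * C powr (1 + d)" .
  qed
  then show ?thesis
    unfolding admissible_iff by (auto simp: mult.assoc intro!: bdd_aboveI[of _ "2 * C powr (1 + d)"])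
qed

lemma F_unbounded:
  assumes "domain \<noteq> {}" shows "\<exists>b\<in>domain. Z \<le> F_fun X \<phi> b"
proof (cases "eps_crit X \<phi>")
  case PInf
  then have dom: "t \<in> domain" if "0 \<le> t" for t using that by (simp add: domain_def)
  have "0 < ln (F_fun X \<phi> 1)" using one_less_F[OF domain_admissible[OF dom], of 1] by simp
  then obtain n :: nat where "Z < real n * ln (F_fun X \<phi> 1)" using reals_Archimedean3 by blast
  \<comment> \<open>\<open>Suc n\<close> keeps the exponent positive, so that \<open>F_scale\<close>
    can compare it with 1 and give ln F(n + 1) >= (n + 1) * ln F(1).\<close>
  then have n: "Z \<le> real (Suc n) * ln (F_fun X \<phi> 1)"
    using \<open>0 < ln (F_fun X \<phi> 1)\<close> by (simp add: algebra_simps)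
  note adm = domain_admissible[OF dom[of "real (Suc n)"]]
  have "ln (F_fun X \<phi> 1) \<le> 1 / real (Suc n) * ln (F_fun X \<phi> (real (Suc n)))"
    by (intro F_scale(2) adm) auto
  then have "real (Suc n) * ln (F_fun X \<phi> 1) \<le> ln (F_fun X \<phi> (real (Suc n)))"
    by (simp add: field_simps)
  also have "\<dots> \<le> F_fun X \<phi> (real (Suc n)) - 1"
    using one_le_F[OF adm] by (intro ln_le_minus_one) auto
  finally show ?thesis using n dom[of "real (Suc n)"] by (intro bexI[of _ "real (Suc n)"]) auto
next
  case MInf
  then show ?thesis using assms by (simp add: domain_def)
next
  case (real e)
  show ?thesis
  proof (rule ccontr)
    assume neg: "\<not> (\<exists>b\<in>domain. Z \<le> F_fun X \<phi> b)"
    \<comment> \<open>If F stayed below Z, one gain d would serve for all exponents in the interval.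
      The maximum with 1 keeps \<open>C\<close> positive.\<close>
    define C where "C = max Z 1"
    define d where "d = 1 / (16 * 2 ^ CARD('n) * C\<^sup>2)"
    have d0: "0 < d" unfolding d_def C_def by simp
    have e0: "0 < e" using assms real by (auto simp: domain_def)
    \<comment> \<open>b is below e but so near that (1 + d) * b exceeds e, contradicting the
      definition of the supremum.\<close>
    define b where "b = e / (1 + d / 2)"
    have "b < e" "0 < b" using d0 e0 by (auto simp: b_def field_simps)
    then have b: "b \<in> domain" using real by (simp add: domain_def)
    then have "F_fun X \<phi> b \<le> C" using neg by (force simp: C_def)
    from admissible_improve[OF domain_admissible[OF b] this d_def]
    have "ereal ((1 + d) * b) \<le> eps_crit X \<phi>"
      unfolding eps_crit_def admissible_def using d0 \<open>0 < b\<close> by (intro Sup_upper) auto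
    then have "(1 + d) * b \<le> e" using real by simp
    moreover have "e < (1 + d) * b" using d0 e0 by (simp add: b_def field_simps)
    ultimately show False by simp
  qed
qed

text \<open>A strictly increasing unbounded function tends to infinity at the right end. Taking the
  limit in the extended reals covers finite and infinite critical exponents with one filter.\<close>

lemma F_tendsto_at_top:
  "filterlim (\<lambda>e. F_fun X \<phi> (real_of_ereal e)) at_top (at_left (eps_crit X \<phi>))"
proof (cases "domain = {}")
  case True
  have "eps_crit X \<phi> = -\<infinity>"
  proof (rule ccontr)
    assume "eps_crit X \<phi> \<noteq> -\<infinity>"
    then have "\<exists>t>0. t \<in> admissible"
      unfolding eps_crit_def admissible_def by (auto simp: bot_ereal_def[symmetric])
    then obtain t where t: "0 < t" "t \<in> admissible" by blast
    have "ereal t \<le> eps_crit X \<phi>"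
      unfolding eps_crit_def using t by (intro Sup_upper) (auto simp: admissible_def)
    then have "ereal 0 < eps_crit X \<phi>" using t(1) by (simp add: less_le_trans[of _ "ereal t"])
    then show False using True by (auto simp: domain_def)
  qed
  \<comment> \<open>Nothing lies to the left of minus infinity, so the filter is trivial.\<close>
  moreover have "{..<-\<infinity>::ereal} = {}" by auto
  ultimately show ?thesis by (simp add: at_within_def filterlim_at_top)
next
  case False
  show ?thesis
    unfolding filterlim_at_top
  proof
    fix Z :: real
    obtain b where b: "b \<in> domain" "Z \<le> F_fun X \<phi> b" using F_unbounded[OF False] by blast
    have b': "0 \<le> b" "ereal b < eps_crit X \<phi>" using b(1) by (auto simp: domain_def)
    have "Z \<le> F_fun X \<phi> (real_of_ereal y)" if y: "ereal b < y" "y < eps_crit X \<phi>" for y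
    proof -
      obtain t where t: "y = ereal t" using y by (cases y) auto
      then have "t \<in> domain" "b < t" using y b' by (auto simp: domain_def)
      then have "F_fun X \<phi> b < F_fun X \<phi> t" using strict_mono_onD[OF F_strict_mono b(1)] by blast
      then show ?thesis using b(2) t by simp
    qed
    then show "\<forall>\<^sub>F e in at_left (eps_crit X \<phi>). Z \<le> F_fun X \<phi> (real_of_ereal e)"
      unfolding eventually_at_left[OF b'(2)] using b'(2) by blast
  qed
qed

end

text \<open>The first conjunct certifies that throughout the interval \<open>F_fun\<close> is a
  genuine finite supremum and not an unspecified value.\<close>

theorem lemma3p1:
  fixes X :: "(real^'n) set" and \<phi> :: "real^'n \<Rightarrow> real"
  assumes "X = UNIV \<or> is_cube X"
    and "\<phi> \<in> BMO X"
    and "\<not> (\<exists>c. AE x in lebesgue. x \<in> X \<longrightarrow> \<phi> x = c)"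
  shows "(\<forall>\<epsilon>. 0 \<le> \<epsilon> \<and> ereal \<epsilon> < eps_crit X \<phi> \<longrightarrow> (\<lambda>x. exp (\<epsilon> * \<phi> x)) \<in> A_infty X) \<and>
    strict_mono_on {\<epsilon>. 0 \<le> \<epsilon> \<and> ereal \<epsilon> < eps_crit X \<phi>} (F_fun X \<phi>) \<and>
    continuous_on {\<epsilon>. 0 \<le> \<epsilon> \<and> ereal \<epsilon> < eps_crit X \<phi>} (F_fun X \<phi>) \<and>
    filterlim (\<lambda>e. F_fun X \<phi> (real_of_ereal e)) at_top (at_left (eps_crit X \<phi>))"
proof -
  interpret exponential_weights X \<phi>
    using assms by unfold_locales (auto simp: BMO_def)
  show ?thesis
    using domain_admissible F_strict_mono F_continuous F_tendsto_at_top
    unfolding domain_def admissible_def by blast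
qed

end
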